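(* Given a set $A\in\mathcal B$ satisfying $\mu(A)>0$, the subset $m_{L^1}(A\cap\mathcal B)=\{m_{L^1}(B): B\in\mathcal B,\ B\subseteq A\}$ is not order bounded in $L^1$. In particular, the range $m_{L^1}(\mathcal B)$ of $m_{L^1}$ is not order bounded in $L^1$.
   Context: $\mu$ is Lebesgue measure on the Borel $\sigma$-algebra $\mathcal B$ of $(-1,1)$, and $L^p=L^p(\mu)$ (complex-valued functions). The finite Hilbert transform of $f\in L^1$ is $T(f)(t):=\lim_{\varepsilon\to0^+}\frac1\pi\left(\int_{-1}^{t-\varepsilon}+\int_{t+\varepsilon}^1\right)\frac{f(x)}{x-t}\,dx$, which exists for a.e. $t\in(-1,1)$ and is measurable. $T$ maps $L^2$ boundedly into $L^2\subseteq L^1$. $m_{L^1}\colon\mathcal B\to L^1$ is the set function $m_{L^1}(A):=T(\chi_A)$, which is $\sigma$-additive (a vector measure). For $A\in\mathcal B$, $A\cap\mathcal B:=\{A\cap B:B\in\mathcal B\}=\{B\in\mathcal B:B\subseteq A\}$. A subset $F\subseteq L^1$ is order bounded if there exists $0\le h\in L^1$ such that $|f|\le h$ (a.e.) for all $f\in F$. *)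

theory Defs
  imports "HOL-Analysis.Analysis"
begin

text \<open>
  Elements of \<open>L\<^sup>1(\<mu>)\<close> are represented by functions, and relations between them are
  required only \<open>\<mu>\<close>-almost everywhere, so nothing below depends on the
  choice of representatives.
\<close>

definition \<mu> :: "real measure" where
  "\<mu> = restrict_space lborel {-1<..<1}"

text \<open>
  For \<open>f \<in> L\<^sup>1\<close> the limit exists for almost every \<open>t \<in> (-1,1)\<close>; at the remaining points
  \<^const>\<open>Lim\<close> has an unspecified value. Only small \<open>\<epsilon>\<close> matter, so it is harmless that
  the intervals of integration become empty for large \<open>\<epsilon>\<close>.
\<close>

definition finite_Hilbert_transform :: "(real \<Rightarrow> complex) \<Rightarrow> real \<Rightarrow> complex" where
  "finite_Hilbert_transform f t =
     Lim (at_right 0) (\<lambda>\<epsilon>. 1 / of_real pi *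
       ((LINT x:{-1<..<t - \<epsilon>}|lborel. f x / of_real (x - t)) +
        (LINT x:{t + \<epsilon><..<1}|lborel. f x / of_real (x - t))))"

definition m_L1 :: "real set \<Rightarrow> real \<Rightarrow> complex" where
  "m_L1 A = finite_Hilbert_transform (indicator A)"

text \<open>
  Membership \<open>F \<subseteq> L\<^sup>1\<close> is deliberately not a conjunct here: otherwise a failure of
  membership would make the negation of this predicate hold trivially.
\<close>

definition order_bounded_L1 :: "(real \<Rightarrow> complex) set \<Rightarrow> bool" where
  "order_bounded_L1 F \<longleftrightarrow>
     (\<exists>h :: real \<Rightarrow> real. integrable \<mu> h \<and> (AE x in \<mu>. 0 \<le> h x) \<and>
        (\<forall>f\<in>F. AE x in \<mu>. cmod (f x) \<le> h x))"

end

theory Submission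
  imports Defs
begin

text \<open>
  No order bound \<open>h\<close> exists, for a pointwise reason: already the countable family
  \<open>B\<^sub>q = A \<inter> (q,1)\<close>, \<open>q\<close> rational, forces \<open>h = \<infinity>\<close> almost everywhere on \<open>A\<close>. Indeed, for \<open>t < q\<close>
  the singularity of the kernel lies outside \<open>B\<^sub>q\<close>, so \<open>\<pi> T(\<chi>\<^bsub>B\<^sub>q\<^esub>)(t)\<close> is the ordinary integral of
  \<open>1/(x-t)\<close> over \<open>x \<in> B\<^sub>q\<close> (lemma \<open>pi_cmod_m_L1_left_of_set\<close>). As \<open>q\<close> decreases to \<open>t\<close>, this integral
  diverges logarithmically at almost every \<open>t \<in> A\<close>, namely at the density points of \<open>A\<close>.

  The proof replaces density points by an averaging argument. A finite \<open>h\<close> is bounded by a constant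
  on a compact set \<open>K \<subseteq> A\<close> of positive measure, so for each \<open>\<epsilon> > 0\<close> the integral of \<open>1/(x-t)\<close> over
  \<open>x \<in> K\<close>, \<open>x \<ge> t + \<epsilon>\<close>, is bounded for almost every \<open>t \<in> K\<close>, by a constant independent of \<open>\<epsilon>\<close>
  and \<open>t\<close>. Integrating over \<open>t \<in> K\<close>, substituting \<open>x = t + s\<close> and exchanging the integrals bounds
  the integral of \<open>\<mu>(K \<inter> (K - s)) / s\<close> over \<open>\<epsilon> \<le> s \<le> d\<close> independently of \<open>\<epsilon>\<close>. But
  \<open>\<mu>(K \<inter> (K - s)) \<ge> c > 0\<close> for small \<open>s\<close>, as in Steinhaus's theorem
  (lemma \<open>compact_translate_overlap\<close>), so for small \<open>d\<close> this integral is at least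
  \<open>c (ln d - ln \<epsilon>)\<close>, which is unbounded as \<open>\<epsilon>\<close> tends to 0 (lemma \<open>truncated_kernel_unbounded\<close>).
\<close>

section \<open>Sets of positive Lebesgue measure\<close>

lemma compact_subset_positive_measure:
  fixes E :: "'a::euclidean_space set"
  assumes E: "E \<in> sets borel" and pos: "emeasure lborel E > 0"
  obtains K where "compact K" "K \<subseteq> E" "emeasure lborel K > 0"
proof -
  obtain n :: nat where n: "emeasure lborel (E \<inter> cball 0 (real n)) > 0"
  proof (rule ccontr)
    assume "\<not> thesis"
    with that have "\<And>n. emeasure lborel (E \<inter> cball 0 (real n)) = 0"
      by (meson not_gr_zero)
    then have "emeasure lborel (\<Union>n. E \<inter> cball 0 (real n)) = 0"
      using E by (intro emeasure_UN_eq_0) auto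
    moreover have "(\<Union>n. E \<inter> cball 0 (real n)) = E"
      by (auto simp: dist_norm intro: real_arch_simple)
    ultimately show False using pos by simp
  qed
  define S where "S = E \<inter> cball 0 (real n)"
  have S: "S \<in> sets borel" using E by (auto simp: S_def)
  have "emeasure lborel S < \<infinity>"
    unfolding S_def by (intro emeasure_bounded_finite) (auto intro: bounded_subset)
  then have meas: "emeasure lborel S = ennreal (measure lborel S)"
    by (simp add: emeasure_eq_ennreal_measure)
  then have "measure lborel S > 0" using n by (simp add: S_def)
  then obtain T where T: "closed T" "T \<subseteq> S" "emeasure lebesgue (S - T) < emeasure lborel S"
    using sets_lebesgue_inner_closed[of S "measure lborel S"] S meas
    by (metis sets_completionI_sets sets_lborel)
  have Tb: "T \<in> sets borel" using T(1) by simp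
  have "emeasure lborel T \<noteq> 0"
  proof
    assume "emeasure lborel T = 0"
    then have "emeasure lborel (S - T) = emeasure lborel S"
      using S Tb by (intro emeasure_Diff_null_set) (auto simp: null_sets_def)
    then show False using T(3) S Tb by simp
  qed
  moreover have "bounded T" using T(2) by (auto simp: S_def intro: bounded_subset)
  ultimately show ?thesis
    using that[of T] T by (auto simp: S_def compact_eq_bounded_closed zero_less_iff_neq_zero)
qed

text \<open>
  The quantitative form of Steinhaus's theorem: for small \<open>s\<close> both \<open>K\<close> and \<open>K - s\<close> lie in an open
  set of measure less than \<open>3/2\<close> times that of \<open>K\<close>, so they cannot be nearly disjoint.
\<close>

lemma compact_translate_overlap:
  fixes K :: "'a::euclidean_space set"
  assumes K: "compact K" and pos: "emeasure lborel K > 0"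
  obtains c d :: real where "c > 0" "d > 0"
    "\<And>s. norm s < d \<Longrightarrow> ennreal c \<le> emeasure lborel {x \<in> K. x + s \<in> K}"
proof -
  have Kb[measurable]: "K \<in> sets borel" using K by (simp add: compact_imp_closed)
  have "emeasure lborel K < \<infinity>" using K by (rule emeasure_compact_finite)
  then have m: "emeasure lborel K = ennreal (measure lborel K)"
    by (simp add: emeasure_eq_ennreal_measure)
  define c where "c = measure lborel K / 2"
  have c: "c > 0" using pos m by (simp add: c_def)
  obtain U where U: "open U" "K \<subseteq> U" "emeasure lborel (U - K) < ennreal c"
    using outer_regular_lborel[of K c] c Kb by auto
  have [measurable]: "U \<in> sets borel" using U by simp
  obtain d where d: "d > 0" "(\<Union>x\<in>K. ball x d) \<subseteq> U"
    using compact_subset_open_imp_ball_epsilon_subset[OF K U(1,2)] by blast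
  have "ennreal c \<le> emeasure lborel {x \<in> K. x + s \<in> K}" if s: "norm s < d" for s
  proof -
    let ?L = "{x. x + s \<in> K}"
    have [measurable]: "?L \<in> sets borel" by measurable
    have L: "emeasure lborel ?L = emeasure lborel K"
    proof -
      have "emeasure lborel K = emeasure (distr lborel borel (\<lambda>x. s + x)) K"
        by (simp add: lborel_distr_plus)
      also have "\<dots> = emeasure lborel ?L"
        by (subst emeasure_distr) (auto simp: vimage_def add.commute)
      finally show ?thesis by simp
    qed
    have "?L \<subseteq> U"
    proof
      fix x assume "x \<in> ?L"
      then have "x + s \<in> K" "x \<in> ball (x + s) d" using s by (auto simp: dist_norm)
      then show "x \<in> U" using d(2) by blast
    qed
    then have "?L - K \<subseteq> U - K" by auto
    then have "emeasure lborel (?L - K) \<le> emeasure lborel (U - K)"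
      by (intro emeasure_mono) auto
    then have "emeasure lborel (?L - K) \<le> ennreal c"
      using U(3) by (meson le_less_trans less_imp_le)
    moreover have "emeasure lborel ?L = emeasure lborel {x \<in> K. x + s \<in> K} + emeasure lborel (?L - K)"
    proof -
      have "?L = {x \<in> K. x + s \<in> K} \<union> (?L - K)" by auto
      moreover have "emeasure lborel {x \<in> K. x + s \<in> K} + emeasure lborel (?L - K)
          = emeasure lborel ({x \<in> K. x + s \<in> K} \<union> (?L - K))"
        by (intro plus_emeasure) auto
      ultimately show ?thesis by simp
    qed
    ultimately have "ennreal (2 * c) \<le> emeasure lborel {x \<in> K. x + s \<in> K} + ennreal c"
      using L m by (simp add: c_def add_left_mono)
    moreover have "ennreal (2 * c) = ennreal c + ennreal c"
      using c by (simp flip: ennreal_plus)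
    ultimately show ?thesis
      by (simp add: add.commute ennreal_add_left_cancel_le)
  qed
  with c d(1) show ?thesis using that by blast
qed

section \<open>Logarithmic divergence of the truncated kernel\<close>

lemma nn_integral_inverse_Icc:
  assumes "0 < a" "a \<le> b"
  shows "(\<integral>\<^sup>+s. ennreal (1 / s) * indicator {a..b} s \<partial>lborel) = ennreal (ln b - ln a)"
proof (rule nn_integral_FTC_Icc)
  fix x assume "x \<in> {a..b}"
  with assms show "(ln has_real_derivative 1 / x) (at x)" and "0 \<le> 1 / x"
    by (auto intro!: derivative_eq_intros)
qed (use assms in auto)

text \<open>
  The truncated integrals of the kernel \<open>1/(x-t)\<close> over a set of positive measure have no common
  almost everywhere bound. The exceptional null set in the hypothesis may depend on \<open>\<epsilon>\<close>.
\<close>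

lemma truncated_kernel_unbounded:
  fixes C :: real
  assumes K: "compact K" and pos: "emeasure lborel K > 0"
    and bound: "\<And>\<epsilon>. \<epsilon> > 0 \<Longrightarrow> AE t in lborel. t \<in> K \<longrightarrow>
      (\<integral>\<^sup>+x. ennreal (1 / (x - t)) * indicator (K \<inter> {t + \<epsilon>..}) x \<partial>lborel) \<le> ennreal C"
  shows False
proof -
  have Kb[measurable]: "K \<in> sets borel" using K by (simp add: compact_imp_closed)
  obtain c d0 where c: "c > 0" and d0: "d0 > 0" and
    ov0: "\<And>s::real. norm s < d0 \<Longrightarrow> ennreal c \<le> emeasure lborel {x \<in> K. x + s \<in> K}"
    using compact_translate_overlap[OF K pos] by metis
  \<comment> \<open>Halving makes the overlap bound valid on the closed interval from 0 to \<open>d\<close>.\<close>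
  define d where "d = d0 / 2"
  have d: "d > 0" using d0 by (simp add: d_def)
  have ov: "ennreal c \<le> emeasure lborel {x \<in> K. x + s \<in> K}" if "0 \<le> s" "s \<le> d" for s
    using that d0 by (intro ov0) (auto simp: d_def)
  define m where "m = measure lborel K"
  have m: "emeasure lborel K = ennreal m"
    using emeasure_compact_finite[OF K] by (simp add: m_def emeasure_eq_ennreal_measure)
  \<comment> \<open>\<open>ennreal\<close> truncates negative reals to 0, so \<open>C\<close> may be replaced by its positive part.\<close>
  define C' where "C' = max C 0"
  have log_bound: "c * (ln d - ln e) \<le> C' * m" if e: "0 < e" "e \<le> d" for e
  proof -
    let ?g = "\<lambda>t s. ennreal (1 / s) * indicator {e..d} s * (indicator K t * indicator K (t + s)) :: ennreal"
    have "ennreal (c * (ln d - ln e)) = ennreal c * (\<integral>\<^sup>+s. ennreal (1 / s) * indicator {e..d} s \<partial>lborel)"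
      using c e by (simp add: nn_integral_inverse_Icc ennreal_mult)
    also have "\<dots> = (\<integral>\<^sup>+s. (ennreal (1 / s) * indicator {e..d} s) * ennreal c \<partial>lborel)"
      by (subst nn_integral_cmult[symmetric]) (auto simp: mult_ac)
    also have "\<dots> \<le> (\<integral>\<^sup>+s. (ennreal (1 / s) * indicator {e..d} s) * emeasure lborel {x \<in> K. x + s \<in> K} \<partial>lborel)"
      using ov e by (intro nn_integral_mono) (auto split: split_indicator intro!: mult_left_mono)
    also have "\<dots> = (\<integral>\<^sup>+s. \<integral>\<^sup>+t. ?g t s \<partial>lborel \<partial>lborel)"
    proof (rule nn_integral_cong)
      fix s :: real
      have "(\<integral>\<^sup>+t. ?g t s \<partial>lborel)
          = (ennreal (1 / s) * indicator {e..d} s) * (\<integral>\<^sup>+t. indicator K t * indicator K (t + s) \<partial>lborel)"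
        by (subst nn_integral_cmult) auto
      also have "(\<integral>\<^sup>+t. indicator K t * indicator K (t + s) \<partial>lborel)
          = (\<integral>\<^sup>+t. indicator {x \<in> K. x + s \<in> K} t \<partial>lborel)"
        by (intro nn_integral_cong) (auto split: split_indicator)
      also have "\<dots> = emeasure lborel {x \<in> K. x + s \<in> K}"
        by (intro nn_integral_indicator) measurable
      finally show "(ennreal (1 / s) * indicator {e..d} s) * emeasure lborel {x \<in> K. x + s \<in> K}
          = (\<integral>\<^sup>+t. ?g t s \<partial>lborel)" by simp
    qed
    also have "\<dots> = (\<integral>\<^sup>+t. \<integral>\<^sup>+s. ?g t s \<partial>lborel \<partial>lborel)"
      by (rule lborel_pair.Fubini') measurable
    also have "\<dots> \<le> (\<integral>\<^sup>+t. ennreal C' * indicator K t \<partial>lborel)"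
    proof (rule nn_integral_mono_AE, use bound[OF e(1)] in eventually_elim)
      case (elim t)
      show ?case
      proof (cases "t \<in> K")
        case True
        have "(\<integral>\<^sup>+s. ?g t s \<partial>lborel)
            \<le> (\<integral>\<^sup>+s. ennreal (1 / (t + 1 * s - t)) * indicator (K \<inter> {t + e..}) (t + 1 * s) \<partial>lborel)"
          by (intro nn_integral_mono) (auto split: split_indicator)
        also have "\<dots> = (\<integral>\<^sup>+x. ennreal (1 / (x - t)) * indicator (K \<inter> {t + e..}) x \<partial>lborel)"
          by (subst nn_integral_real_affine[where c = 1 and t = t]) auto
        also have "\<dots> \<le> ennreal C'"
          using elim True by (auto simp: C'_def intro: order_trans ennreal_leI)
        finally show ?thesis using True by simp
      qed simp
    qed
    also have "\<dots> = ennreal (C' * m)"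
      by (subst nn_integral_cmult_indicator) (auto simp: m ennreal_mult' C'_def)
    finally show ?thesis
      by (subst (asm) ennreal_le_iff) (auto simp: C'_def m_def)
  qed
  \<comment> \<open>The lower limit \<open>e = d exp (- L)\<close> makes the left-hand side equal to \<open>c L\<close>.\<close>
  define L where "L = C' * m / c + 1"
  have "L > 0" using c by (auto simp: L_def C'_def m_def intro!: add_nonneg_pos divide_nonneg_pos)
  then have "c * (ln d - ln (d * exp (- L))) \<le> C' * m"
    using d by (intro log_bound) auto
  moreover have "ln (d * exp (- L)) = ln d - L" using d by (simp add: ln_mult)
  ultimately have "c * L \<le> C' * m" by simp
  then show False using c by (simp add: L_def distrib_left)
qed

section \<open>The vector measure to the left of a set, and its range\<close>

text \<open>
  To the left of \<open>B\<close> the truncations in the principal value are eventually inactive, so the limit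
  exists at every such \<open>t\<close>, and it is nonnegative, so the modulus is the value itself.
\<close>

lemma pi_cmod_m_L1_left_of_set:
  assumes B: "B \<in> sets borel" "B \<subseteq> {q<..<1}" and t: "-1 < t" "t < q"
  shows "ennreal (pi * cmod (m_L1 B t)) = (\<integral>\<^sup>+x. ennreal (1 / (x - t)) * indicator B x \<partial>lborel)"
proof -
  note [measurable] = B(1)
  define I where "I = (LINT x:B|lborel. 1 / (x - t))"
  have int: "set_integrable lborel B (\<lambda>x. 1 / (x - t))"
    unfolding set_integrable_def
  proof (rule integrableI_bounded_set_indicator[where B = "1 / (q - t)"])
    have "emeasure lborel B \<le> emeasure lborel {q<..<1}" using B by (intro emeasure_mono) auto
    then show "emeasure lborel B < \<infinity>"
      using emeasure_bounded_finite[of "{q<..<1}"] by (auto intro: le_less_trans)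
    show "AE x in lborel. x \<in> B \<longrightarrow> norm (1 / (x - t)) \<le> 1 / (q - t)"
      using B(2) t by (intro AE_I2) (auto intro!: divide_left_mono)
  qed (use B in auto)
  have I: "ennreal I = (\<integral>\<^sup>+x. ennreal (1 / (x - t)) * indicator B x \<partial>lborel)" and I0: "0 \<le> I"
  proof -
    have nonneg: "0 \<le> indicator B x *\<^sub>R (1 / (x - t))" for x
      using B(2) t by (auto split: split_indicator)
    show "0 \<le> I" unfolding I_def set_lebesgue_integral_def
      using nonneg by (intro integral_nonneg_AE) auto
    have "(\<integral>\<^sup>+x. ennreal (1 / (x - t)) * indicator B x \<partial>lborel)
        = (\<integral>\<^sup>+x. ennreal (indicator B x *\<^sub>R (1 / (x - t))) \<partial>lborel)"
      by (intro nn_integral_cong) (auto split: split_indicator)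
    also have "\<dots> = ennreal I" unfolding I_def set_lebesgue_integral_def
      by (rule nn_integral_eq_integral[OF int[unfolded set_integrable_def]]) (use nonneg in simp)
    finally show "ennreal I = (\<integral>\<^sup>+x. ennreal (1 / (x - t)) * indicator B x \<partial>lborel)" by simp
  qed
  have "m_L1 B t = 1 / of_real pi * of_real I"
    unfolding m_L1_def finite_Hilbert_transform_def
  proof (rule tendsto_Lim)
    have "\<forall>\<^sub>F \<epsilon> in at_right 0. \<epsilon> \<in> {0<..<q - t}"
      using t by (intro eventually_at_right_real) auto
    then have "\<forall>\<^sub>F \<epsilon> in at_right 0. 1 / of_real pi * complex_of_real I =
       1 / of_real pi *
       ((LINT x:{-1<..<t - \<epsilon>}|lborel. indicator B x / of_real (x - t)) +
        (LINT x:{t + \<epsilon><..<1}|lborel. indicator B x / of_real (x - t)))"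
    proof eventually_elim
      case (elim \<epsilon>)
      have l: "(LINT x:{-1<..<t - \<epsilon>}|lborel. indicator B x / complex_of_real (x - t)) = 0"
        unfolding set_lebesgue_integral_def using B(2) t elim
        by (intro integral_eq_zero_AE AE_I2) (auto split: split_indicator)
      have "(LINT x:{t + \<epsilon><..<1}|lborel. indicator B x / complex_of_real (x - t))
          = (LINT x|lborel. of_real (indicator B x *\<^sub>R (1 / (x - t))))"
        unfolding set_lebesgue_integral_def using B(2) t elim
        by (intro Bochner_Integration.integral_cong) (auto split: split_indicator)
      also have "\<dots> = of_real I"
        unfolding I_def set_lebesgue_integral_def by (rule integral_of_real[OF int[unfolded set_integrable_def]])
      finally show ?case using l by simp
    qed
    then show "((\<lambda>\<epsilon>. 1 / of_real pi *
       ((LINT x:{-1<..<t - \<epsilon>}|lborel. indicator B x / of_real (x - t)) +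
        (LINT x:{t + \<epsilon><..<1}|lborel. indicator B x / of_real (x - t))))
        \<longlongrightarrow> 1 / of_real pi * complex_of_real I) (at_right 0)"
      by (rule tendsto_eventually[OF eventually_mono]) simp
  qed simp
  then have "pi * cmod (m_L1 B t) = I" using I0 by (simp add: norm_mult norm_divide)
  then show ?thesis using I by simp
qed

lemma not_order_bounded_m_L1:
  assumes A: "A \<in> sets \<mu>" and pos: "emeasure \<mu> A > 0"
  shows "\<not> order_bounded_L1 (m_L1 ` {B \<in> sets \<mu>. B \<subseteq> A})"
proof
  assume "order_bounded_L1 (m_L1 ` {B \<in> sets \<mu>. B \<subseteq> A})"
  then obtain h where h: "integrable \<mu> h"
    and dom: "\<And>B. B \<in> sets \<mu> \<Longrightarrow> B \<subseteq> A \<Longrightarrow> AE x in \<mu>. cmod (m_L1 B x) \<le> h x"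
    unfolding order_bounded_L1_def by blast
  have sets_\<mu>: "B \<in> sets \<mu> \<longleftrightarrow> B \<in> sets borel \<and> B \<subseteq> {-1<..<1}" for B
    by (auto simp: \<mu>_def sets_restrict_space_iff)
  have Ab: "A \<in> sets borel" "A \<subseteq> {-1<..<1}" using A by (auto simp: sets_\<mu>)
  obtain M :: nat where M: "emeasure lborel {t \<in> A. h t \<le> real M} > 0"
    and Mb: "{t \<in> A. h t \<le> real M} \<in> sets borel"
  proof -
    have hm[measurable]: "h \<in> borel_measurable \<mu>" using h by simp
    have sets: "{t \<in> A. h t \<le> real M} \<in> sets \<mu>" for M :: nat
    proof -
      have "{t \<in> space \<mu>. h t \<le> real M} \<inter> A \<in> sets \<mu>" using A by measurable
      moreover have "{t \<in> space \<mu>. h t \<le> real M} \<inter> A = {t \<in> A. h t \<le> real M}"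
        using sets.sets_into_space[OF A] by auto
      ultimately show ?thesis by simp
    qed
    have "\<exists>M::nat. emeasure \<mu> {t \<in> A. h t \<le> real M} > 0"
    proof (rule ccontr)
      assume "\<not> ?thesis"
      then have "emeasure \<mu> (\<Union>M::nat. {t \<in> A. h t \<le> real M}) = 0"
        using sets by (intro emeasure_UN_eq_0) (auto simp: not_gr_zero)
      moreover have "(\<Union>M::nat. {t \<in> A. h t \<le> real M}) = A"
        by (auto intro: real_arch_simple)
      ultimately show False using pos by simp
    qed
    then obtain M :: nat where "emeasure \<mu> {t \<in> A. h t \<le> real M} > 0" by blast
    moreover have "emeasure \<mu> {t \<in> A. h t \<le> real M} = emeasure lborel {t \<in> A. h t \<le> real M}"
      unfolding \<mu>_def using Ab by (intro emeasure_restrict_space) auto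
    ultimately show ?thesis using that[of M] sets[of M] by (simp add: sets_\<mu>)
  qed
  obtain K where K: "compact K" "K \<subseteq> {t \<in> A. h t \<le> real M}" "emeasure lborel K > 0"
    using compact_subset_positive_measure[OF Mb M] by blast
  have "AE t in lborel. \<forall>q\<in>\<rat>. t \<in> {-1<..<1} \<longrightarrow> cmod (m_L1 (A \<inter> {q<..<1}) t) \<le> h t"
  proof (rule AE_ball_countable')
    fix q :: real
    have "AE t in \<mu>. cmod (m_L1 (A \<inter> {q<..<1}) t) \<le> h t"
      using Ab by (intro dom) (auto simp: sets_\<mu>)
    then show "AE t in lborel. t \<in> {-1<..<1} \<longrightarrow> cmod (m_L1 (A \<inter> {q<..<1}) t) \<le> h t"
      unfolding \<mu>_def by (subst (asm) AE_restrict_space_iff) auto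
  qed (rule countable_rat)
  then have "AE t in lborel. t \<in> K \<longrightarrow>
      (\<integral>\<^sup>+x. ennreal (1 / (x - t)) * indicator (K \<inter> {t + \<epsilon>..}) x \<partial>lborel) \<le> ennreal (pi * real M)"
    if \<epsilon>: "\<epsilon> > 0" for \<epsilon>
  proof eventually_elim
    case (elim t)
    show ?case
    proof
      assume t: "t \<in> K"
      then have t1: "t \<in> {-1<..<1}" "h t \<le> real M" using K(2) Ab by auto
      \<comment> \<open>A rational cut-off: the null sets of only countably many sets \<open>A \<inter> {q<..<1}\<close> are discarded.\<close>
      obtain q where q: "q \<in> \<rat>" "t < q" "q < t + \<epsilon>"
        using Rats_dense_in_real[of t "t + \<epsilon>"] \<epsilon> by auto
      have "(\<integral>\<^sup>+x. ennreal (1 / (x - t)) * indicator (K \<inter> {t + \<epsilon>..}) x \<partial>lborel)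
          \<le> (\<integral>\<^sup>+x. ennreal (1 / (x - t)) * indicator (A \<inter> {q<..<1}) x \<partial>lborel)"
        using K(2) Ab(2) q by (intro nn_integral_mono) (auto split: split_indicator)
      also have "\<dots> = ennreal (pi * cmod (m_L1 (A \<inter> {q<..<1}) t))"
        using Ab t1 q by (intro pi_cmod_m_L1_left_of_set[symmetric, where q = q]) auto
      also have "\<dots> \<le> ennreal (pi * real M)"
        using elim q t1 by (intro ennreal_leI mult_left_mono) force+
      finally show "(\<integral>\<^sup>+x. ennreal (1 / (x - t)) * indicator (K \<inter> {t + \<epsilon>..}) x \<partial>lborel)
          \<le> ennreal (pi * real M)" .
    qed
  qed
  then show False by (rule truncated_kernel_unbounded[OF K(1,3)])
qed

theorem corollary3p6:
  shows "(\<forall>A\<in>sets \<mu>. emeasure \<mu> A > 0 \<longrightarrow>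
            \<not> order_bounded_L1 (m_L1 ` {B \<in> sets \<mu>. B \<subseteq> A}))
         \<and> \<not> order_bounded_L1 (m_L1 ` sets \<mu>)"
proof
  show "\<forall>A\<in>sets \<mu>. emeasure \<mu> A > 0 \<longrightarrow>
      \<not> order_bounded_L1 (m_L1 ` {B \<in> sets \<mu>. B \<subseteq> A})"
    using not_order_bounded_m_L1 by blast
  have "emeasure \<mu> (space \<mu>) > 0"
    by (simp add: \<mu>_def space_restrict_space emeasure_restrict_space)
  then have "\<not> order_bounded_L1 (m_L1 ` {B \<in> sets \<mu>. B \<subseteq> space \<mu>})"
    by (intro not_order_bounded_m_L1) auto
  moreover have "{B \<in> sets \<mu>. B \<subseteq> space \<mu>} = sets \<mu>"
    using sets.sets_into_space by blast
  ultimately show "\<not> order_bounded_L1 (m_L1 ` sets \<mu>)" by simp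
qed

end
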